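(* For every integer $m\ge 4$, there is an orthogonal array OA$(2^{2^m-m-1},\,2^m-2,\,2,\,2^{m-1}-1)$ that is not a punctured $1$-perfect code.
   Context: The $n$-cube $Q_n$ is the graph with vertex set $\{0,1\}^n$ in which two words are adjacent iff they differ in exactly one coordinate. A (binary) orthogonal array OA$(N,n,2,t)$ is a multiset $C$ of $N$ elements of $\{0,1\}^n$ such that every subcube obtained by fixing the values of $t$ coordinates (i.e. every subgraph of $Q_n$ isomorphic to $Q_{n-t}$) contains exactly $N/2^t$ elements of $C$, counted with multiplicity. A set $P\subseteq\{0,1\}^n$ is a $1$-perfect code if every ball of radius $1$ in $Q_n$ (a vertex together with its $n$ neighbors) contains exactly one element of $P$. For a set $D$ of words and a symbol $b\in\{0,1\}$, $D|b$ denotes the set of words obtained by appending $b$ at the end of each word of $D$. A set $C\subseteq\{0,1\}^n$ is a punctured $1$-perfect code if $C=C'\cup C''$ for some $C',C''\subseteq\{0,1\}^n$ such that $C'|0\,\cup\, C''|1$ is a $1$-perfect code in $Q_{n+1}$. *)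

theory Defs
  imports Main "HOL-Library.Multiset"
begin

definition words :: "nat \<Rightarrow> bool list set" where
  "words n = {w. length w = n}"

definition cube_adj :: "nat \<Rightarrow> bool list \<Rightarrow> bool list \<Rightarrow> bool" where
  "cube_adj n u v \<longleftrightarrow> u \<in> words n \<and> v \<in> words n \<and> card {i. i < n \<and> u ! i \<noteq> v ! i} = 1"

definition unit_ball :: "nat \<Rightarrow> bool list \<Rightarrow> bool list set" where
  "unit_ball n v = insert v {u. cube_adj n v u}"

definition subcube :: "nat \<Rightarrow> nat set \<Rightarrow> (nat \<Rightarrow> bool) \<Rightarrow> bool list set" where
  "subcube n T a = {w \<in> words n. \<forall>i\<in>T. w ! i = a i}"

text \<open>The count in each subcube is \<open>N / 2 ^ t\<close>; the denominator is cleared so that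
  natural-number division does not round.\<close>

definition orthogonal_array :: "nat \<Rightarrow> nat \<Rightarrow> nat \<Rightarrow> bool list multiset \<Rightarrow> bool" where
  "orthogonal_array N n t C \<longleftrightarrow>
     t \<le> n \<and> set_mset C \<subseteq> words n \<and> size C = N \<and>
     (\<forall>T a. T \<subseteq> {..<n} \<and> card T = t \<longrightarrow>
        size (filter_mset (\<lambda>w. w \<in> subcube n T a) C) * 2 ^ t = N)"

definition one_perfect_code :: "nat \<Rightarrow> bool list set \<Rightarrow> bool" where
  "one_perfect_code n P \<longleftrightarrow> P \<subseteq> words n \<and> (\<forall>v\<in>words n. \<exists>!c. c \<in> P \<and> c \<in> unit_ball n v)"

definition append_symbol :: "bool list set \<Rightarrow> bool \<Rightarrow> bool list set" where
  "append_symbol D b = (\<lambda>w. w @ [b]) ` D"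

definition punctured_one_perfect_code :: "nat \<Rightarrow> bool list set \<Rightarrow> bool" where
  "punctured_one_perfect_code n C \<longleftrightarrow>
     (\<exists>C' C''. C' \<subseteq> words n \<and> C'' \<subseteq> words n \<and> C = C' \<union> C'' \<and>
        one_perfect_code (n + 1) (append_symbol C' False \<union> append_symbol C'' True))"

end

theory Submission
  imports Defs
begin

text \<open>
  The array is a set \<open>C\<close> of words in which no two are adjacent and every word outside \<open>C\<close> has
  exactly two neighbours in \<open>C\<close>. Both conditions together say that, for the indicator \<open>f\<close> of
  \<open>C\<close> and the adjacency operator \<open>A\<close> of the \<open>n\<close>-cube, \<open>A f + 2 f = 2\<close> pointwise
  (\<open>two_fold\<close>). This gives orthogonality: up to a constant, \<open>f\<close> is an eigenvector of \<open>A\<close> for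
  the eigenvalue \<open>-2\<close>, so the function \<open>F\<close> that counts \<open>C\<close> in the subcubes fixing \<open>t\<close>
  given coordinates is, up to a constant, an eigenvector of the \<open>t\<close>-cube for the eigenvalue
  \<open>-(n - t + 2)\<close>. The eigenvalues of the \<open>t\<close>-cube are at least \<open>-t\<close>; hence \<open>F\<close> is constant as
  soon as \<open>2 * t < n + 2\<close> (\<open>two_fold_subcube_count\<close>). For \<open>n = 2 ^ m - 2\<close> this covers all
  \<open>t \<le> 2 ^ (m - 1) - 1\<close>.

  The obstruction to being a punctured perfect code is a graph: join two words of \<open>C\<close> when
  they are at distance two. If \<open>C = C' \<union> C''\<close> comes from a perfect code, then \<open>C'\<close> and
  \<open>C''\<close> each have minimum distance three, so they are the two classes of a proper colouring
  (\<open>punctured_two_colourable\<close>). It remains to find codes whose distance-two graph has an odd cycle.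

  In length 14, cut a word into groups of length 4, 4, 4 and 2. In a group of length 4, each of
  the four flips changes the parity, and together they lead to each of the four values of a pair
  of bits, the hue, once. The code asks that the first three groups have the same parity \<open>e\<close>,
  and that \<open>e\<close> plus the parity of the last group be \<open>G\<close> of the three hues. This is two-fold
  for every \<open>G\<close> on the \<open>4 \<times> 4 \<times> 4\<close> grid that takes each value twice on each axis-parallel
  line: when one of the three parities differs from the others, the neighbours in \<open>C\<close> arise by
  moving along one such line. A step at distance two inside one of the three groups moves to
  the other point of the line with the same value of \<open>G\<close>. For a linear \<open>G\<close> the resulting graph
  is bipartite; the non-linear \<open>G\<close> chosen below gives a cycle of length seven
  (\<open>not_two_colourable_code14\<close>).

  Larger \<open>m\<close> follow by a doubling construction from length \<open>n\<close> to length \<open>2 * n + 2\<close>, which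
  preserves the two-fold property (\<open>two_fold_doubling\<close>) and contains the old code in a subcube,
  so that odd cycles survive (\<open>two_colourable_doubling\<close>).
\<close>

section \<open>Two-fold codes and the distance-two graph\<close>

definition flip :: "bool list \<Rightarrow> nat \<Rightarrow> bool list" where
  "flip x i = x[i := \<not> x ! i]"

lemma length_flip [simp]: "length (flip x i) = length x"
  by (simp add: flip_def)

lemma flip_in_words [simp]: "flip x i \<in> words n \<longleftrightarrow> x \<in> words n"
  by (simp add: words_def)

lemma nth_flip: "i < length x \<Longrightarrow> flip x i ! k = (if k = i then \<not> x ! i else x ! k)"
  by (cases "k = i") (auto simp: flip_def)

lemma flip_flip [simp]: "flip (flip x i) i = x"
  by (cases "i < length x") (auto simp: flip_def list_update_beyond)

lemma flip_Cons_0 [simp]: "flip (b # x) 0 = (\<not> b) # x"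
  and flip_Cons_Suc [simp]: "flip (b # x) (Suc i) = b # flip x i"
  by (auto simp: flip_def)

lemma flip_append1: "i < length x \<Longrightarrow> flip (x @ y) i = flip x i @ y"
  by (simp add: flip_def list_update_append nth_append)

lemma flip_append2: "flip (x @ y) (length x + i) = x @ flip y i"
  by (simp add: flip_def list_update_append nth_append)

definition neighbour_sum :: "(bool list \<Rightarrow> int) \<Rightarrow> bool list \<Rightarrow> int" where
  "neighbour_sum F x = (\<Sum>i<length x. F (flip x i))"

lemma neighbour_sum_Nil [simp]: "neighbour_sum F [] = 0"
  by (simp add: neighbour_sum_def)

lemma neighbour_sum_Cons [simp]:
  "neighbour_sum F (b # x) = F ((\<not> b) # x) + neighbour_sum (\<lambda>y. F (b # y)) x"
  by (simp add: neighbour_sum_def sum.lessThan_Suc_shift del: sum.lessThan_Suc)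

lemma neighbour_sum_append:
  "neighbour_sum F (x @ y) = neighbour_sum (\<lambda>u. F (u @ y)) x + neighbour_sum (\<lambda>v. F (x @ v)) y"
  by (induction x arbitrary: F) (auto simp: algebra_simps)

lemma neighbour_sum_cong:
  assumes "\<And>i. i < length x \<Longrightarrow> F (flip x i) = G (flip x i)"
  shows "neighbour_sum F x = neighbour_sum G x"
  using assms by (auto simp: neighbour_sum_def intro: sum.cong)

text \<open>The coefficient 2 merges two conditions into one equation: a word of the code has no neighbour
  in the code, and any other word has exactly two.\<close>
definition two_fold :: "nat \<Rightarrow> bool list set \<Rightarrow> bool" where
  "two_fold n C \<longleftrightarrow> C \<subseteq> words n \<and>
     (\<forall>x\<in>words n. neighbour_sum (\<lambda>y. of_bool (y \<in> C)) x + 2 * of_bool (x \<in> C) = 2)"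

definition two_step :: "nat \<Rightarrow> bool list \<Rightarrow> bool list \<Rightarrow> bool" where
  "two_step n x y \<longleftrightarrow> (\<exists>i<n. \<exists>j<n. i \<noteq> j \<and> y = flip (flip x i) j)"

text \<open>Bipartiteness of the distance-two graph, in the form of a proper colouring: it restricts to
  subcubes directly, and no walks have to be handled.\<close>
definition two_colourable :: "nat \<Rightarrow> bool list set \<Rightarrow> bool" where
  "two_colourable n C \<longleftrightarrow>
     (\<exists>\<chi> :: bool list \<Rightarrow> bool. \<forall>x\<in>C. \<forall>y\<in>C. two_step n x y \<longrightarrow> \<chi> x \<noteq> \<chi> y)"

lemma finite_words [simp]: "finite (words n)"
  using finite_lists_length_eq[of "UNIV :: bool set" n] by (simp add: words_def)

lemma card_words: "card (words n) = 2 ^ n"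
  using card_lists_length_eq[of "UNIV :: bool set" n] by (simp add: words_def)

lemma two_step_append_right:
  assumes "two_step n x y" "length x = n"
  shows "two_step (n + k) (x @ z) (y @ z)"
proof -
  obtain i j where "i < n" "j < n" "i \<noteq> j" "y = flip (flip x i) j"
    using assms(1) by (auto simp: two_step_def)
  then show ?thesis
    unfolding two_step_def using assms(2)
    by (intro exI[of _ i] exI[of _ j] conjI) (simp_all add: flip_append1)
qed

lemma two_step_append_left:
  assumes "two_step n x y"
  shows "two_step (length z + n) (z @ x) (z @ y)"
proof -
  obtain i j where "i < n" "j < n" "i \<noteq> j" "y = flip (flip x i) j"
    using assms by (auto simp: two_step_def)
  then show ?thesis
    unfolding two_step_def
    by (intro exI[of _ "length z + i"] exI[of _ "length z + j"] conjI) (simp_all add: flip_append2)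
qed

section \<open>Two-fold codes are orthogonal arrays\<close>

lemma flip_in_subcube:
  assumes "x \<in> subcube n T a" "i < n"
  shows "flip x i \<in> subcube n T (a(i := \<not> a i))"
proof -
  have "flip x i ! k = (a(i := \<not> a i)) k" if "k \<in> T" for k
    using assms that by (cases "k = i") (simp_all add: subcube_def words_def nth_flip)
  with assms show ?thesis by (simp add: subcube_def)
qed

lemma flip_image_subcube:
  assumes "i < n"
  shows "(\<lambda>x. flip x i) ` subcube n T a = subcube n T (a(i := \<not> a i))"
proof
  show "(\<lambda>x. flip x i) ` subcube n T a \<subseteq> subcube n T (a(i := \<not> a i))"
    using assms by (intro image_subsetI flip_in_subcube)
  show "subcube n T (a(i := \<not> a i)) \<subseteq> (\<lambda>x. flip x i) ` subcube n T a"
  proof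
    fix y assume "y \<in> subcube n T (a(i := \<not> a i))"
    from flip_in_subcube[OF this assms] have "flip y i \<in> subcube n T a" by simp
    then show "y \<in> (\<lambda>x. flip x i) ` subcube n T a"
      by (rule rev_image_eqI) simp
  qed
qed

lemma inj_flip: "inj_on (\<lambda>x. flip x i) A"
  by (metis flip_flip inj_onI)

lemma sum_flip_subcube:
  assumes "i < n"
  shows "(\<Sum>x\<in>subcube n T a. F (flip x i)) = sum F (subcube n T (a(i := \<not> a i)))"
  using sum.reindex[OF inj_flip, of F i "subcube n T a"]
  by (simp only: flip_image_subcube[OF assms] comp_def)

lemma finite_subcube [simp]: "finite (subcube n T a)"
  by (rule finite_subset[OF _ finite_words[of n]]) (auto simp: subcube_def)

text \<open>Summing \<open>A f + 2 f = 2\<close> over a subcube: flipping a free coordinate permutes the subcube, which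
  gives \<open>n - card T\<close> copies of \<open>F a\<close>, while flipping a fixed coordinate leads to a neighbouring
  parallel subcube.\<close>
lemma two_fold_subcube_equation:
  fixes F :: "(nat \<Rightarrow> bool) \<Rightarrow> int"
  assumes C: "two_fold n C" and T: "T \<subseteq> {..<n}"
  defines "F \<equiv> \<lambda>a. \<Sum>x\<in>subcube n T a. of_bool (x \<in> C)"
  shows "(\<Sum>i\<in>T. F (a(i := \<not> a i))) + (int n - int (card T) + 2) * F a
           = 2 * int (card (subcube n T a))"
proof -
  have fin: "finite T" using T by (rule finite_subset) simp
  let ?f = "\<lambda>x. of_bool (x \<in> C) :: int"
  have "2 * int (card (subcube n T a)) = (\<Sum>x\<in>subcube n T a. neighbour_sum ?f x + 2 * ?f x)"
    using C by (simp add: two_fold_def subcube_def)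
  also have "\<dots> = (\<Sum>x\<in>subcube n T a. \<Sum>i<n. ?f (flip x i)) + 2 * F a"
    by (simp add: neighbour_sum_def F_def sum.distrib sum_distrib_left subcube_def words_def)
  also have "(\<Sum>x\<in>subcube n T a. \<Sum>i<n. ?f (flip x i)) =
             (\<Sum>i<n. F (a(i := \<not> a i)))"
    unfolding F_def
    by (subst sum.swap, rule sum.cong)
       (simp_all only: lessThan_iff sum_flip_subcube[of _ n ?f T a])
  also have "\<dots> = (\<Sum>i\<in>T. F (a(i := \<not> a i))) + (\<Sum>i\<in>{..<n} - T. F a)"
  proof -
    have "F (a(i := \<not> a i)) = F a" if "i \<notin> T" for i
    proof -
      have "subcube n T (a(i := \<not> a i)) = subcube n T a"
        using that by (auto simp: subcube_def)
      then show ?thesis by (simp only: F_def)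
    qed
    then show ?thesis by (simp add: sum.subset_diff[OF T])
  qed
  also have "(\<Sum>i\<in>{..<n} - T. F a) = (int n - int (card T)) * F a"
    using card_mono[OF _ T] by (simp add: card_Diff_subset[OF fin T] of_nat_diff)
  finally show ?thesis by (simp only: distrib_right add.assoc)
qed

lemma card_subcube:
  assumes T: "T \<subseteq> {..<n}"
  shows "card (subcube n T a) * 2 ^ card T = 2 ^ n"
proof -
  have fin: "finite T" using T by (rule finite_subset) simp
  have "T \<subseteq> {..<n} \<Longrightarrow> card (subcube n T a) * 2 ^ card T = 2 ^ n"
    using fin
  proof (induction T rule: finite_induct)
    case empty
    then show ?case by (simp add: subcube_def card_words)
  next
    case (insert i T)
    let ?b = "a(i := \<not> a i)"
    have i: "i < n" using insert by auto
    have split: "subcube n T a = subcube n (insert i T) a \<union> subcube n (insert i T) ?b"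
      using insert.hyps by (auto simp: subcube_def)
    have disj: "subcube n (insert i T) a \<inter> subcube n (insert i T) ?b = {}"
      by (auto simp: subcube_def)
    from card_image[OF inj_flip[of i "subcube n (insert i T) a"]]
    have "card (subcube n (insert i T) ?b) = card (subcube n (insert i T) a)"
      by (simp add: flip_image_subcube[OF i])
    with split disj have "card (subcube n T a) = 2 * card (subcube n (insert i T) a)"
      by (simp add: card_Un_disjoint)
    with insert show ?case by simp
  qed
  with T show ?thesis by blast
qed

text \<open>A maximum principle in place of the spectrum of the cube: \<open>G\<close>, the deviation of the count from
  its mean, scaled to be an integer, has \<open>n - card T + 2\<close> times its absolute value bounded
  by the sum of the absolute values at \<open>card T\<close> neighbouring arguments. Where \<open>\<bar>G\<bar>\<close> is largest
  this forces \<open>G = 0\<close>.\<close>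
lemma two_fold_subcube_count:
  assumes C: "two_fold n C" and T: "T \<subseteq> {..<n}" and small: "2 * card T < n + 2"
  shows "(n + 2) * card (C \<inter> subcube n T a) * 2 ^ card T = 2 * 2 ^ n"
proof -
  define t where "t = int (card T)"
  define F where "F a = (\<Sum>x\<in>subcube n T a. of_bool (x \<in> C) :: int)" for a
  define c where "c = card (subcube n T a)"
  have c: "card (subcube n T b) = c" for b
    using card_subcube[OF T, of b] card_subcube[OF T, of a]
    by (metis c_def mult_cancel2 power_eq_0_iff zero_neq_numeral)
  define G where "G a = (int n + 2) * F a - 2 * int c" for a
  have eq: "(\<Sum>i\<in>T. G (b(i := \<not> b i))) = - (int n - t + 2) * G b" for b
  proof -
    have "(\<Sum>i\<in>T. F (b(i := \<not> b i))) = 2 * int c - (int n - t + 2) * F b"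
      using two_fold_subcube_equation[OF C T, of b] c[of b] by (simp add: F_def t_def)
    moreover have "(\<Sum>i\<in>T. G (b(i := \<not> b i))) =
        (int n + 2) * (\<Sum>i\<in>T. F (b(i := \<not> b i))) - t * (2 * int c)"
      by (simp only: G_def sum_subtractf sum_distrib_left sum_constant t_def)
    ultimately show ?thesis by (simp only: G_def) (simp add: algebra_simps)
  qed
  \<comment> \<open>There are infinitely many \<open>a\<close>, but \<open>G a\<close> depends only on the subcube, a subset of a finite set.\<close>
  have fin_range: "finite (range (\<lambda>a. \<bar>G a\<bar>))"
  proof -
    have "range (\<lambda>a. \<bar>G a\<bar>) \<subseteq>
        (\<lambda>S. \<bar>(int n + 2) * (\<Sum>x\<in>S. of_bool (x \<in> C)) - 2 * int c\<bar>) ` Pow (words n)"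
    proof (rule image_subsetI)
      fix a
      have "subcube n T a \<in> Pow (words n)" by (auto simp: subcube_def)
      then show "\<bar>G a\<bar> \<in>
          (\<lambda>S. \<bar>(int n + 2) * (\<Sum>x\<in>S. of_bool (x \<in> C)) - 2 * int c\<bar>) ` Pow (words n)"
        unfolding G_def F_def by (rule rev_image_eqI) (rule refl)
    qed
    then show ?thesis by (rule finite_subset) simp
  qed
  then have "Max (range (\<lambda>a. \<bar>G a\<bar>)) \<in> range (\<lambda>a. \<bar>G a\<bar>)" by (rule Max_in) simp
  then obtain b where "Max (range (\<lambda>a. \<bar>G a\<bar>)) = \<bar>G b\<bar>" by blast
  then have b: "\<bar>G a\<bar> \<le> \<bar>G b\<bar>" for a
    using Max_ge[OF fin_range, of "\<bar>G a\<bar>"] by simp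
  have pos: "int n - t + 2 > t" using small by (simp add: t_def)
  have "(int n - t + 2) * \<bar>G b\<bar> = \<bar>\<Sum>i\<in>T. G (b(i := \<not> b i))\<bar>"
    using pos by (simp add: eq abs_mult t_def)
  also have "\<dots> \<le> (\<Sum>i\<in>T. \<bar>G (b(i := \<not> b i))\<bar>)" by (rule sum_abs)
  also have "\<dots> \<le> (\<Sum>i\<in>T. \<bar>G b\<bar>)" by (rule sum_mono) (rule b)
  also have "\<dots> = t * \<bar>G b\<bar>" by (simp add: t_def)
  finally have "(int n - t + 2) * \<bar>G b\<bar> \<le> t * \<bar>G b\<bar>" .
  with pos have "G b = 0" by (simp add: mult_le_cancel_right)
  then have "G a = 0" using b[of a] by simp
  then have "int ((n + 2) * card (C \<inter> subcube n T a)) = int (2 * c)"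
    by (simp add: G_def F_def Int_commute algebra_simps)
  then have "(n + 2) * card (C \<inter> subcube n T a) = 2 * c" by (simp only: of_nat_eq_iff)
  then show ?thesis using card_subcube[OF T, of a] by (simp add: c_def)
qed

text \<open>The exponent is that of \<open>2 * 2 ^ n / (n + 2)\<close> at \<open>n = 2 ^ m - 2\<close>.\<close>
lemma two_fold_orthogonal_array:
  assumes C: "two_fold (2 ^ m - 2) C" and m: "m \<ge> 2"
  shows "orthogonal_array (2 ^ (2 ^ m - m - 1)) (2 ^ m - 2) (2 ^ (m - 1) - 1) (mset_set C)"
proof -
  let ?n = "2 ^ m - 2 :: nat"
  have pm: "(2::nat) ^ m = 2 * 2 ^ (m - 1)"
    using m by (cases m) auto
  have "(2::nat) ^ 1 \<le> 2 ^ (m - 1)" using m by (intro power_increasing) auto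
  then have two: "(2::nat) \<le> 2 ^ (m - 1)" by simp
  have "m < 2 ^ m" by (rule less_exp)
  then have "Suc ?n = m + (2 ^ m - m - 1)" using two pm by linarith
  then have exp: "2 * 2 ^ ?n = (2 ^ m * 2 ^ (2 ^ m - m - 1) :: nat)"
    by (simp only: power_add flip: power_Suc)
  have fin: "finite C" and sub: "C \<subseteq> words ?n"
    using C finite_subset[OF _ finite_words] by (auto simp: two_fold_def)
  have count: "card (C \<inter> subcube ?n T a) * 2 ^ card T = 2 ^ (2 ^ m - m - 1)"
    if "T \<subseteq> {..<?n}" "card T \<le> 2 ^ (m - 1) - 1" for T a
  proof -
    have "2 * card T < ?n + 2" using that two pm by linarith
    moreover have "?n + 2 = 2 ^ m" using two pm by linarith
    ultimately have
      "2 ^ m * (card (C \<inter> subcube ?n T a) * 2 ^ card T) = 2 ^ m * (2 ^ (2 ^ m - m - 1) :: nat)"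
      using two_fold_subcube_count[OF C that(1), of a] exp by (simp only: mult.assoc)
    then show ?thesis by simp
  qed
  have "C \<inter> subcube ?n {} (\<lambda>_. False) = C" using sub by (auto simp: subcube_def)
  with count[of "{}" "\<lambda>_. False"] have "card C = 2 ^ (2 ^ m - m - 1)" by simp
  moreover have "size (filter_mset (\<lambda>w. w \<in> subcube ?n T a) (mset_set C)) = card (C \<inter> subcube ?n T a)"
    for T a
    using fin by (simp add: Int_def)
  moreover have "2 ^ (m - 1) - 1 \<le> ?n" using two pm by simp
  ultimately show ?thesis
    unfolding orthogonal_array_def using fin sub count
    by (metis finite_set_mset_mset_set order_refl size_mset_set)
qed

section \<open>The colouring induced by a punctured perfect code\<close>

lemma flip_cube_adj:
  assumes "z \<in> words n" "i < n"
  shows "cube_adj n z (flip z i)"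
proof -
  have "(k < n \<and> z ! k \<noteq> flip z i ! k) = (k = i)" for k
    using assms by (cases "k = i") (simp_all add: nth_flip words_def)
  then have "{k. k < n \<and> z ! k \<noteq> flip z i ! k} = {i}" by simp
  then show ?thesis using assms by (simp add: cube_adj_def)
qed

text \<open>The word halfway between two words at distance two has both of them in its ball.\<close>
lemma one_perfect_code_no_two_step:
  assumes P: "one_perfect_code n P" and "x \<in> P" "y \<in> P"
  shows "\<not> two_step n x y"
proof
  assume "two_step n x y"
  then obtain i j where ij: "i < n" "j < n" "i \<noteq> j" "y = flip (flip x i) j"
    by (auto simp: two_step_def)
  have x: "x \<in> words n" using assms by (auto simp: one_perfect_code_def)
  let ?z = "flip x i"
  have "x \<in> unit_ball n ?z" "y \<in> unit_ball n ?z"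
    using flip_cube_adj[of ?z n i] flip_cube_adj[of ?z n j] x ij by (auto simp: unit_ball_def)
  moreover have "\<exists>!c. c \<in> P \<and> c \<in> unit_ball n ?z"
    using P x by (simp add: one_perfect_code_def)
  ultimately have "x = y" using assms(2,3) by blast
  moreover have "y ! i \<noteq> x ! i"
    using ij x by (simp add: nth_flip words_def)
  ultimately show False by simp
qed

lemma punctured_two_colourable:
  assumes "punctured_one_perfect_code n D"
  shows "two_colourable n D"
proof -
  obtain C' C'' where w: "C' \<subseteq> words n" "C'' \<subseteq> words n" and D: "D = C' \<union> C''"
    and P: "one_perfect_code (n + 1) (append_symbol C' False \<union> append_symbol C'' True)"
    using assms by (auto simp: punctured_one_perfect_code_def)
  have lift: "two_step (n + 1) (x @ [b]) (y @ [b])" if "two_step n x y" "x \<in> words n" for x y b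
    using that by (intro two_step_append_right) (simp_all add: words_def)
  have 1: "\<not> two_step n x y" if "x \<in> C'" "y \<in> C'" for x y
    using one_perfect_code_no_two_step[OF P, of "x @ [False]" "y @ [False]"] lift[of x y False] that w
    by (auto simp: append_symbol_def)
  have 2: "\<not> two_step n x y" if "x \<in> C''" "y \<in> C''" for x y
    using one_perfect_code_no_two_step[OF P, of "x @ [True]" "y @ [True]"] lift[of x y True] that w
    by (auto simp: append_symbol_def)
  have "\<forall>x\<in>D. \<forall>y\<in>D. two_step n x y \<longrightarrow> (x \<in> C') \<noteq> (y \<in> C')"
    using 1 2 D by blast
  then show ?thesis
    unfolding two_colourable_def by (intro exI[of _ "\<lambda>x. x \<in> C'"]) simp
qed

section \<open>Doubling the length\<close>

primrec parity :: "bool list \<Rightarrow> bool" where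
  "parity [] = False"
| "parity (b # x) = (b \<noteq> parity x)"

lemma parity_flip: "i < length x \<Longrightarrow> parity (flip x i) = (\<not> parity x)"
proof (induction x arbitrary: i)
  case (Cons b x)
  then show ?case by (cases i) auto
qed simp

definition xor_word :: "bool list \<Rightarrow> bool list \<Rightarrow> bool list" where
  "xor_word = map2 (\<noteq>)"

lemma length_xor_word [simp]: "length (xor_word x y) = min (length x) (length y)"
  by (simp add: xor_word_def)

lemma xor_word_flip:
  assumes "length x = length y"
  shows "i < length x \<Longrightarrow> xor_word (flip x i) y = flip (xor_word x y) i"
    and "i < length x \<Longrightarrow> xor_word x (flip y i) = flip (xor_word x y) i"
  using assms by (auto intro!: nth_equalityI simp: nth_flip xor_word_def)

text \<open>Flipping a letter of \<open>x\<close> or of \<open>y\<close> flips the same letter of \<open>x + y\<close>. The parity condition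
  selects which of the two moves can reach the code from a given word, so that each neighbour of
  \<open>x + y\<close> in \<open>C\<close> is counted once and not twice. The letters \<open>s\<close> and \<open>t\<close> make up for the parity: when
  it is violated and \<open>x + y\<close> lies in \<open>C\<close>, flipping either of them gives the two required neighbours.\<close>
definition doubling :: "nat \<Rightarrow> bool list set \<Rightarrow> bool list set" where
  "doubling n C = {x @ y @ [s, t] | x y s t. x \<in> words n \<and> y \<in> words n \<and>
      xor_word x y \<in> C \<and> parity x = (s \<noteq> t)}"

lemma in_doubling:
  assumes "x \<in> words n" "y \<in> words n"
  shows "x @ y @ [s, t] \<in> doubling n C \<longleftrightarrow> xor_word x y \<in> C \<and> parity x = (s \<noteq> t)"
  using assms by (auto simp: doubling_def words_def)

lemma two_fold_doubling:
  assumes "two_fold n C"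
  shows "two_fold (2 * n + 2) (doubling n C)"
proof -
  let ?D = "doubling n C"
  have "neighbour_sum (\<lambda>y. of_bool (y \<in> ?D)) w + 2 * of_bool (w \<in> ?D) = 2"
    if len_w: "w \<in> words (2 * n + 2)" for w
  proof -
    obtain x y s t where w: "w = x @ y @ [s, t]" and x: "x \<in> words n" and y: "y \<in> words n"
    proof -
      have "length (drop (2 * n) w) = 2" using len_w by (simp add: words_def)
      then obtain s t where "drop (2 * n) w = [s, t]"
        unfolding numeral_2_eq_2 length_Suc_conv by auto
      moreover have "w = take n w @ take n (drop n w) @ drop (2 * n) w"
        by (metis append_take_drop_id drop_drop mult_2)
      ultimately show ?thesis
        using that[of "take n w" "take n (drop n w)" s t] len_w
        by (simp add: words_def)
    qed
    let ?z = "xor_word x y" and ?f = "\<lambda>z. of_bool (z \<in> C) :: int"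
    have len: "length x = length y" "length ?z = length x" using x y by (auto simp: words_def)
    \<comment> \<open>With \<open>e\<close>, the \<open>y\<close>-flips keep the parity condition; without it, the \<open>x\<close>-flips restore it.\<close>
    define e where "e \<longleftrightarrow> parity x = (s \<noteq> t)"
    have z: "neighbour_sum ?f ?z + 2 * ?f ?z = 2"
      using assms x y by (simp add: two_fold_def words_def)
    have "neighbour_sum (\<lambda>u. of_bool (u @ y @ [s, t] \<in> ?D)) x =
          (\<Sum>i<length x. of_bool (\<not> e) * ?f (flip ?z i))"
      unfolding neighbour_sum_def
      by (rule sum.cong) (use x y len in \<open>auto simp: in_doubling xor_word_flip parity_flip e_def\<close>)
    also have "\<dots> = of_bool (\<not> e) * neighbour_sum ?f ?z"
      by (simp add: neighbour_sum_def len sum_distrib_left del: sum_of_bool_eq sum_of_bool_mult_eq)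
    finally have 1: "neighbour_sum (\<lambda>u. of_bool (u @ y @ [s, t] \<in> ?D)) x =
      of_bool (\<not> e) * neighbour_sum ?f ?z" .
    have "neighbour_sum (\<lambda>v. of_bool (x @ v @ [s, t] \<in> ?D)) y =
          (\<Sum>i<length x. of_bool e * ?f (flip ?z i))"
      unfolding neighbour_sum_def
      by (rule sum.cong) (use x y len in \<open>auto simp: in_doubling xor_word_flip e_def\<close>)
    also have "\<dots> = of_bool e * neighbour_sum ?f ?z"
      by (simp add: neighbour_sum_def len sum_distrib_left del: sum_of_bool_eq sum_of_bool_mult_eq)
    finally have 2: "neighbour_sum (\<lambda>v. of_bool (x @ v @ [s, t] \<in> ?D)) y =
      of_bool e * neighbour_sum ?f ?z" .
    show ?thesis
      using z by (cases e) (auto simp: w neighbour_sum_append 1 2 in_doubling x y e_def)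
  qed
  moreover have "?D \<subseteq> words (2 * n + 2)"
    by (auto simp: doubling_def words_def)
  ultimately show ?thesis by (simp add: two_fold_def)
qed

text \<open>Fixing \<open>x\<close>, \<open>s\<close> and \<open>t\<close> to zero leaves a copy of \<open>C\<close> inside the doubled code.\<close>
lemma two_colourable_doubling:
  assumes C: "C \<subseteq> words n" and col: "two_colourable (2 * n + 2) (doubling n C)"
  shows "two_colourable n C"
proof -
  obtain \<chi> where \<chi>: "\<And>x y. x \<in> doubling n C \<Longrightarrow> y \<in> doubling n C \<Longrightarrow>
      two_step (2 * n + 2) x y \<Longrightarrow> \<chi> x \<noteq> (\<chi> y :: bool)"
    using col by (auto simp: two_colourable_def)
  let ?o = "replicate n False"
  let ?emb = "\<lambda>y. ?o @ y @ [False, False]"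
  have o: "?o \<in> words n" by (simp add: words_def)
  have par: "parity (replicate k False) = False" for k by (induction k) auto
  have xor: "xor_word ?o y = y" if "y \<in> words n" for y
    using that by (auto intro!: nth_equalityI simp: words_def xor_word_def)
  have mem: "?emb y \<in> doubling n C" if "y \<in> C" for y
  proof -
    have y: "y \<in> words n" using that C by blast
    show ?thesis using that unfolding in_doubling[OF o y] xor[OF y] by (simp add: par)
  qed
  have step: "two_step (2 * n + 2) (?emb x) (?emb y)" if "two_step n x y" "x \<in> words n" for x y
  proof -
    have "two_step (n + 2) (x @ [False, False]) (y @ [False, False])"
      using that by (intro two_step_append_right) (simp_all add: words_def)
    from two_step_append_left[OF this, of ?o] show ?thesis by (simp add: mult_2 add.assoc)
  qed
  have "\<chi> (?emb x) \<noteq> \<chi> (?emb y)" if "x \<in> C" "y \<in> C" "two_step n x y" for x y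
    using \<chi>[OF mem mem step] that C by blast
  then show ?thesis
    unfolding two_colourable_def by (intro exI[of _ "\<lambda>y. \<chi> (?emb y)"]) simp
qed

section \<open>A code of length 14 with an odd cycle\<close>

text \<open>The syndrome of a word of length 4 for the columns \<open>11, 10, 01, 00\<close>: the four flips add the
  four distinct columns, so they reach each value once.\<close>
definition hue :: "bool list \<Rightarrow> bool \<times> bool" where
  "hue u = (u ! 0 \<noteq> u ! 1, u ! 0 \<noteq> u ! 2)"

text \<open>Modulo 2 this is \<open>a + c + (if y then q + b * p else p)\<close>. It is balanced on each line because
  a bit of the moving hue is a separate summand: \<open>a\<close> for the first hue, \<open>c\<close> for the third, and \<open>q\<close>
  or \<open>p\<close>, according to \<open>y\<close>, for the second. The selection by \<open>y\<close> and the
  product \<open>b * p\<close> make it non-linear, which is what permits an odd cycle.\<close>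
fun cube_rule :: "bool \<times> bool \<Rightarrow> bool \<times> bool \<Rightarrow> bool \<times> bool \<Rightarrow> bool" where
  "cube_rule (a, b) (p, q) (y, c) = (a \<noteq> (c \<noteq> (if y then q \<noteq> (b \<and> p) else p)))"

definition code14 :: "bool list set" where
  "code14 = {u @ v @ w @ s | u v w s. u \<in> words 4 \<and> v \<in> words 4 \<and> w \<in> words 4 \<and> s \<in> words 2 \<and>
     parity u = parity v \<and> parity v = parity w \<and>
     (parity s \<noteq> parity w) = cube_rule (hue u) (hue v) (hue w)}"

lemma in_code14:
  assumes "u \<in> words 4" "v \<in> words 4" "w \<in> words 4" "s \<in> words 2"
  shows "u @ v @ w @ s \<in> code14 \<longleftrightarrow> parity u = parity v \<and> parity v = parity w \<and>
     (parity s \<noteq> parity w) = cube_rule (hue u) (hue v) (hue w)"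
  using assms by (auto simp: code14_def words_def)

text \<open>The passage from flips of letters to the points of a line of the grid: the sum over the four
  neighbours within a group becomes a sum over all hues at the opposite parity.\<close>
lemma neighbour_sum_hue:
  assumes "u \<in> words 4"
  shows "neighbour_sum (\<lambda>u. \<phi> (parity u) (hue u)) u = (\<Sum>h\<in>UNIV. \<phi> (\<not> parity u) h)"
proof -
  obtain b0 b1 b2 b3 where "u = [b0, b1, b2, b3]"
    using assms by (auto simp: words_def numeral_eq_Suc length_Suc_conv)
  then show ?thesis
    by (cases b0; cases b1; cases b2; cases b3)
       (simp_all add: hue_def UNIV_bool flip: UNIV_Times_UNIV)
qed

lemma neighbour_sum_parity_pair:
  assumes "s \<in> words 2"
  shows "neighbour_sum (\<lambda>s. \<phi> (parity s)) s = 2 * \<phi> (\<not> parity s)"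
proof -
  obtain b0 b1 where "s = [b0, b1]"
    using assms by (auto simp: words_def numeral_eq_Suc length_Suc_conv)
  then show ?thesis by simp
qed

lemma two_fold_code14: "two_fold 14 code14"
proof -
  have "neighbour_sum (\<lambda>y. of_bool (y \<in> code14)) x + 2 * of_bool (x \<in> code14) = 2"
    if x14: "x \<in> words 14" for x
  proof -
    obtain u v w s where x: "x = u @ v @ w @ s"
      and mem: "u \<in> words 4" "v \<in> words 4" "w \<in> words 4" "s \<in> words 2"
    proof
      show "x = take 4 x @ take 4 (drop 4 x) @ take 4 (drop 8 x) @ drop 12 x"
        using append_take_drop_id[of 4 x] append_take_drop_id[of 4 "drop 4 x"]
          append_take_drop_id[of 4 "drop 8 x"] by simp
    qed (use x14 in \<open>simp_all add: words_def\<close>)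
    \<comment> \<open>Membership seen through parities and hues only; what remains is a finite case distinction.\<close>
    define \<Phi> :: "bool \<Rightarrow> _ \<Rightarrow> bool \<Rightarrow> _ \<Rightarrow> bool \<Rightarrow> _ \<Rightarrow> bool \<Rightarrow> int"
      where "\<Phi> e h f k g l d = of_bool (e = f \<and> f = g \<and> (d \<noteq> g) = cube_rule h k l)"
        for e h f k g l d
    have f: "of_bool (u @ v @ w @ s \<in> code14) =
        \<Phi> (parity u) (hue u) (parity v) (hue v) (parity w) (hue w) (parity s)"
      if "u \<in> words 4" "v \<in> words 4" "w \<in> words 4" "s \<in> words 2" for u v w s
      using that by (simp add: in_code14 \<Phi>_def)
    have "neighbour_sum (\<lambda>y. of_bool (y \<in> code14)) x =
        neighbour_sum (\<lambda>u. \<Phi> (parity u) (hue u) (parity v) (hue v) (parity w) (hue w) (parity s)) u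
      + neighbour_sum (\<lambda>v. \<Phi> (parity u) (hue u) (parity v) (hue v) (parity w) (hue w) (parity s)) v
      + neighbour_sum (\<lambda>w. \<Phi> (parity u) (hue u) (parity v) (hue v) (parity w) (hue w) (parity s)) w
      + neighbour_sum (\<lambda>s. \<Phi> (parity u) (hue u) (parity v) (hue v) (parity w) (hue w) (parity s)) s"
      unfolding x neighbour_sum_append using mem
      by (simp add: f cong: neighbour_sum_cong)
    also have "\<dots> =
        (\<Sum>h\<in>UNIV. \<Phi> (\<not> parity u) h (parity v) (hue v) (parity w) (hue w) (parity s))
      + (\<Sum>h\<in>UNIV. \<Phi> (parity u) (hue u) (\<not> parity v) h (parity w) (hue w) (parity s))
      + (\<Sum>h\<in>UNIV. \<Phi> (parity u) (hue u) (parity v) (hue v) (\<not> parity w) h (parity s))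
      + 2 * \<Phi> (parity u) (hue u) (parity v) (hue v) (parity w) (hue w) (\<not> parity s)"
      using mem neighbour_sum_hue[of u "\<lambda>e h. \<Phi> e h (parity v) (hue v) (parity w) (hue w) (parity s)"]
        neighbour_sum_hue[of v "\<lambda>e h. \<Phi> (parity u) (hue u) e h (parity w) (hue w) (parity s)"]
        neighbour_sum_hue[of w "\<lambda>e h. \<Phi> (parity u) (hue u) (parity v) (hue v) e h (parity s)"]
        neighbour_sum_parity_pair[of s
          "\<Phi> (parity u) (hue u) (parity v) (hue v) (parity w) (hue w)"]
      by simp
    finally show ?thesis
      unfolding f[OF mem, folded x]
      by (cases "hue u"; cases "hue v"; cases "hue w"; cases "parity u"; cases "parity v";
          cases "parity w"; cases "parity s")
         (auto simp: \<Phi>_def UNIV_bool simp del: sum_of_bool_eq simp flip: UNIV_Times_UNIV)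
  qed
  moreover have "code14 \<subseteq> words 14"
    by (auto simp: code14_def words_def)
  ultimately show ?thesis by (simp add: two_fold_def)
qed

text \<open>The odd cycle has seven words, each with a single letter 1 in each of the first three groups
  and zeros in the last; two consecutive words differ in the position of one of these letters.
  The second group takes three of the seven steps, around the triangle of positions 0, 1, 2; the
  other two groups go back and forth.\<close>
lemma not_two_colourable_code14: "\<not> two_colourable 14 code14"
proof
  assume "two_colourable 14 code14"
  then obtain \<chi> where \<chi>: "\<And>x y. x \<in> code14 \<Longrightarrow> y \<in> code14 \<Longrightarrow> two_step 14 x y \<Longrightarrow>
      \<chi> x \<noteq> (\<chi> y :: bool)"
    by (auto simp: two_colourable_def)
  define hot :: "nat \<Rightarrow> bool list" where "hot i = [i = 0, i = 1, i = 2, i = 3]" for i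
  define W where "W i j k = hot i @ hot j @ hot k @ [False, False]" for i j k
  have len: "length (hot i) = 4" for i by (simp add: hot_def)
  have mem: "W 1 0 0 \<in> code14" "W 1 0 2 \<in> code14" "W 1 1 2 \<in> code14" "W 0 1 2 \<in> code14"
    "W 0 1 0 \<in> code14" "W 0 2 0 \<in> code14" "W 1 2 0 \<in> code14"
    unfolding W_def
    by (subst in_code14; simp add: words_def hue_def hot_def)+
  have hot: "two_step 4 (hot i) (hot i')" if "i < 4" "i' < 4" "i \<noteq> i'" for i i'
  proof -
    have "flip (flip (hot i) i) i' = hot i'"
      using that by (auto simp: hot_def less_Suc_eq numeral_eq_Suc flip_def)
    with that show ?thesis unfolding two_step_def by metis
  qed
  have 1: "two_step 14 (W i j k) (W i' j k)" if "i < 4" "i' < 4" "i \<noteq> i'" for i i' j k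
    using two_step_append_right[OF hot[OF that] len, of 10 "hot j @ hot k @ [False, False]"]
    by (simp add: W_def)
  have 2: "two_step 14 (W i j k) (W i j' k)" if "j < 4" "j' < 4" "j \<noteq> j'" for i j j' k
    using two_step_append_left[OF two_step_append_right[OF hot[OF that] len], of "hot i" 6
        "hot k @ [False, False]"]
    by (simp add: W_def len)
  have 3: "two_step 14 (W i j k) (W i j k')" if "k < 4" "k' < 4" "k \<noteq> k'" for i j k k'
    using two_step_append_left[OF two_step_append_right[OF hot[OF that] len], of "hot i @ hot j" 2
        "[False, False]"]
    by (simp add: W_def len)
  have "\<chi> (W 1 0 0) \<noteq> \<chi> (W 1 0 2)" "\<chi> (W 1 0 2) \<noteq> \<chi> (W 1 1 2)" "\<chi> (W 1 1 2) \<noteq> \<chi> (W 0 1 2)"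
    "\<chi> (W 0 1 2) \<noteq> \<chi> (W 0 1 0)" "\<chi> (W 0 1 0) \<noteq> \<chi> (W 0 2 0)" "\<chi> (W 0 2 0) \<noteq> \<chi> (W 1 2 0)"
    "\<chi> (W 1 2 0) \<noteq> \<chi> (W 1 0 0)"
    by (intro \<chi> mem 1 2 3; simp)+
  then show False by auto
qed

section \<open>Codes that are not punctured perfect codes\<close>

lemma exists_two_fold_not_two_colourable:
  assumes "m \<ge> 4"
  shows "\<exists>C. two_fold (2 ^ m - 2) C \<and> \<not> two_colourable (2 ^ m - 2) C"
  using assms
proof (induction m rule: dec_induct)
  case base
  then show ?case using two_fold_code14 not_two_colourable_code14 by auto
next
  case (step m)
  then obtain C where C: "two_fold (2 ^ m - 2) C" "\<not> two_colourable (2 ^ m - 2) C" by blast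
  have "(2::nat) ^ 1 \<le> 2 ^ m" using step by (intro power_increasing) auto
  then have n: "2 ^ Suc m - 2 = 2 * (2 ^ m - 2) + (2 :: nat)" by simp
  have "two_fold (2 ^ Suc m - 2) (doubling (2 ^ m - 2) C)"
    unfolding n using C(1) by (rule two_fold_doubling)
  moreover have "\<not> two_colourable (2 ^ Suc m - 2) (doubling (2 ^ m - 2) C)"
    unfolding n using C two_colourable_doubling by (auto simp: two_fold_def)
  ultimately show ?case by blast
qed

theorem theorem5:
  fixes m :: nat
  assumes "m \<ge> 4"
  shows "\<exists>C. orthogonal_array (2 ^ (2 ^ m - m - 1)) (2 ^ m - 2) (2 ^ (m - 1) - 1) C \<and>
           \<not> (\<exists>D. punctured_one_perfect_code (2 ^ m - 2) D \<and> C = mset_set D)"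
proof -
  obtain C where C: "two_fold (2 ^ m - 2) C" "\<not> two_colourable (2 ^ m - 2) C"
    using exists_two_fold_not_two_colourable[OF assms] by blast
  have fin: "finite C" using C(1) finite_subset[OF _ finite_words] by (auto simp: two_fold_def)
  have "\<not> punctured_one_perfect_code (2 ^ m - 2) D" if "mset_set C = mset_set D" for D
  proof
    assume D: "punctured_one_perfect_code (2 ^ m - 2) D"
    then have "finite D"
      by (auto simp: punctured_one_perfect_code_def intro: finite_subset[OF _ finite_words])
    with that fin have "D = C" by (metis finite_set_mset_mset_set)
    with D C(2) show False using punctured_two_colourable by blast
  qed
  with two_fold_orthogonal_array[OF C(1)] assms show ?thesis by auto
qed

end
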